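(* Let $n$ be a positive integer and let $\mathbf{A}=(a_{i,j})\in\mathbb{R}^{n\times n}$ be a matrix with non-negative entries and $\mathrm{perm}(\mathbf A)>0$. Then $$\frac{\mathrm{perm}_{\mathrm{B},2}(\mathbf A)}{\mathrm{perm}(\mathbf A)}=\sqrt{\sum_{\sigma_1,\sigma_2\in\mathcal S_n}p(\sigma_1)\cdot p(\sigma_2)\cdot 2^{-c(\sigma_1,\sigma_2)}},$$ where $p(\sigma)=\dfrac{\prod_{i\in[n]}a_{i,\sigma(i)}}{\mathrm{perm}(\mathbf A)}$ is the probability mass function on $\mathcal S_n$ induced by $\mathbf A$, and $c(\sigma_1,\sigma_2)$ is the number of cycles of length larger than one in the cycle decomposition of the permutation $\sigma_1\circ\sigma_2^{-1}$.
   Context: Notation: $[n]=\{1,\dots,n\}$; $\mathcal S_n$ is the group of permutations of $[n]$; $\mathrm{perm}(\mathbf B)=\sum_{\sigma\in\mathcal S_m}\prod_{i\in[m]}b_{i,\sigma(i)}$ for an $m\times m$ matrix $\mathbf B$. Degree-$M$ Bethe permanent: for a positive integer $M$, let $\tilde\Phi_M$ be the set of all families $\tilde{\mathbf P}=\{\tilde{\mathbf P}^{(i,j)}\}_{i,j\in[n]}$ of $M\times M$ permutation matrices (so $|\tilde\Phi_M|=(M!)^{n^2}$). For $\tilde{\mathbf P}\in\tilde\Phi_M$ let $\mathbf A^{\uparrow\tilde{\mathbf P}}$ be the $(Mn)\times(Mn)$ block matrix whose $(i,j)$ block is $a_{i,j}\tilde{\mathbf P}^{(i,j)}$. Then $$\mathrm{perm}_{\mathrm{B},M}(\mathbf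 A)=\Bigl(\frac{1}{|\tilde\Phi_M|}\sum_{\tilde{\mathbf P}\in\tilde\Phi_M}\mathrm{perm}(\mathbf A^{\uparrow\tilde{\mathbf P}})\Bigr)^{1/M}.$$ *)

theory Defs
  imports "Jordan_Normal_Form.Matrix" "HOL-Combinatorics.Orbits"
begin

text \<open>Matrix rows and columns are indexed from 0, so the index set \<open>[n]\<close> becomes \<open>{0..<n}\<close>.\<close>

definition permanent :: "real mat \<Rightarrow> real" where
  "permanent A = (if dim_row A = dim_col A
     then (\<Sum>\<sigma> | \<sigma> permutes {0..<dim_row A}. \<Prod>i = 0..<dim_row A. A $$ (i, \<sigma> i)) else 0)"

definition perm_matrices :: "nat \<Rightarrow> real mat set" where
  "perm_matrices M =
     {mat M M (\<lambda>(k, l). if l = \<sigma> k then 1 else 0) | \<sigma>. \<sigma> permutes {0..<M}}"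

text \<open>
  The extensional function space makes a family depend on the indices below \<open>n\<close> only, so that the
  number of families is \<open>(fact M) ^ (n\<^sup>2)\<close>.
\<close>

definition perm_matrix_families :: "nat \<Rightarrow> nat \<Rightarrow> (nat \<times> nat \<Rightarrow> real mat) set" where
  "perm_matrix_families n M = ({0..<n} \<times> {0..<n}) \<rightarrow>\<^sub>E perm_matrices M"

text \<open>
  Row \<open>r\<close> of the lifted matrix is row \<open>r mod M\<close> of block row \<open>r div M\<close>, and likewise for columns.
\<close>

definition lift_matrix :: "nat \<Rightarrow> real mat \<Rightarrow> (nat \<times> nat \<Rightarrow> real mat) \<Rightarrow> real mat" where
  "lift_matrix M A P = mat (M * dim_row A) (M * dim_col A)
     (\<lambda>(r, s). (A $$ (r div M, s div M) \<cdot>\<^sub>m P (r div M, s div M)) $$ (r mod M, s mod M))"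

definition bethe_permanent :: "nat \<Rightarrow> real mat \<Rightarrow> real" where
  "bethe_permanent M A = root M
     (1 / real (card (perm_matrix_families (dim_row A) M)) *
      (\<Sum>P\<in>perm_matrix_families (dim_row A) M. permanent (lift_matrix M A P)))"

definition perm_pmf :: "real mat \<Rightarrow> (nat \<Rightarrow> nat) \<Rightarrow> real" where
  "perm_pmf A \<sigma> = (\<Prod>i = 0..<dim_row A. A $$ (i, \<sigma> i)) / permanent A"

text \<open>
  The cycles of a permutation of a finite set are identified with their supports, i.e. with the
  orbits; the length of a cycle is the cardinality of its support.
\<close>

definition nontrivial_cycles :: "nat \<Rightarrow> (nat \<Rightarrow> nat) \<Rightarrow> nat set set" where
  "nontrivial_cycles n \<pi> = {C. C \<subseteq> {0..<n} \<and> cyclic_on \<pi> C \<and> card C > 1}"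

definition cycle_count :: "nat \<Rightarrow> (nat \<Rightarrow> nat) \<Rightarrow> (nat \<Rightarrow> nat) \<Rightarrow> nat" where
  "cycle_count n \<sigma>1 \<sigma>2 = card (nontrivial_cycles n (\<sigma>1 \<circ> Hilbert_Choice.inv \<sigma>2))"

end

(* A permutation tau of the doubled index set S x bool survives in the lifted permanent with average
weight 2^(fix - 2 n), where fix counts the rows i whose two copies are sent to the same block column.
Choosing one copy of each row so that both the chosen and the remaining copies cover every block
column once splits tau into two permutations (sigma, rho) of S. Such a choice exists because the
graph formed by the pairs of copies of rows and columns consists of even cycles. Any two choices
differ by a set D with sigma(D) = rho(D), which rho carries to a subset invariant under
sigma o rho^-1, so there are 2^(fix + c(sigma, rho)) of them. Conversely each (sigma, rho) together
with a choice of row copies arises from 2^n permutations tau. Counting pairs (tau, choice) twice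
turns the average over tau into the sum of 2^(-c) over (sigma, rho). *)

theory Submission
  imports Defs
begin

section \<open>Cycles and invariant sets of a permutation\<close>

text \<open>Distinct cycles are disjoint, and an invariant set contains the whole orbit of each of
  its points, so it is the union of a unique set of cycles. Hence a permutation with
  \<open>k\<close> cycles, fixed points included, has \<open>2 ^ k\<close> invariant
  subsets.\<close>

lemma bij_betw_Union_cyclic_invariant:
  assumes "finite S" "\<pi> permutes S"
  shows "bij_betw Union (Pow {C. C \<subseteq> S \<and> cyclic_on \<pi> C}) {D. D \<subseteq> S \<and> \<pi> ` D = D}"
proof (rule bij_betwI[where g = "\<lambda>D. {C. C \<subseteq> D \<and> cyclic_on \<pi> C}"])
  show "Union \<in> Pow {C. C \<subseteq> S \<and> cyclic_on \<pi> C} \<rightarrow> {D. D \<subseteq> S \<and> \<pi> ` D = D}"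
  proof
    fix X assume X: "X \<in> Pow {C. C \<subseteq> S \<and> cyclic_on \<pi> C}"
    have "\<pi> ` \<Union>X \<subseteq> \<Union>X" using X cyclic_on_inI by fast
    moreover have sub: "\<Union>X \<subseteq> S" using X by blast
    moreover have "finite (\<Union>X)" using sub assms(1) by (rule finite_subset)
    ultimately have "\<pi> ` \<Union>X = \<Union>X"
      using inj_on_subset[OF permutes_inj_on[OF assms(2)]] by (intro endo_inj_surj) auto
    then show "\<Union>X \<in> {D. D \<subseteq> S \<and> \<pi> ` D = D}" using X by blast
  qed
next
  show "(\<lambda>D. {C. C \<subseteq> D \<and> cyclic_on \<pi> C}) \<in> {D. D \<subseteq> S \<and> \<pi> ` D = D} \<rightarrow> Pow {C. C \<subseteq> S \<and> cyclic_on \<pi> C}"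
    by blast
next
  fix X assume X: "X \<in> Pow {C. C \<subseteq> S \<and> cyclic_on \<pi> C}"
  show "{C. C \<subseteq> \<Union>X \<and> cyclic_on \<pi> C} = X"
  proof (intro Set.set_eqI iffI)
    fix C assume "C \<in> {C. C \<subseteq> \<Union>X \<and> cyclic_on \<pi> C}"
    then obtain x C' where "x \<in> C" "C' \<in> X" "x \<in> C'" "cyclic_on \<pi> C"
      unfolding cyclic_on_def by blast
    moreover have "cyclic_on \<pi> C'" using X \<open>C' \<in> X\<close> by blast
    ultimately show "C \<in> X" using orbit_cyclic_eq3 by metis
  qed (use X in auto)
next
  fix D assume D: "D \<in> {D. D \<subseteq> S \<and> \<pi> ` D = D}"
  show "\<Union>{C. C \<subseteq> D \<and> cyclic_on \<pi> C} = D"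
  proof
    show "D \<subseteq> \<Union>{C. C \<subseteq> D \<and> cyclic_on \<pi> C}"
    proof
      fix x assume "x \<in> D"
      have "y \<in> D" if "y \<in> orbit \<pi> x" for y
        using that by induct (use D \<open>x \<in> D\<close> in auto)
      moreover have "cyclic_on \<pi> (orbit \<pi> x)" using assms by (simp add: cyclic_on_orbit)
      moreover have "x \<in> orbit \<pi> x" using assms permutation_permutes permutation_self_in_orbit by fast
      ultimately show "x \<in> \<Union>{C. C \<subseteq> D \<and> cyclic_on \<pi> C}" by blast
    qed
  qed blast
qed

text \<open>\<open>cyclic_on\<close> also admits singletons, which are exactly the fixed points;
  they have to be separated from the cycles that \<open>cycle_count\<close> counts.\<close>

lemma card_cyclic_subsets:
  assumes "finite S" "\<pi> permutes S"
  shows "card {C. C \<subseteq> S \<and> cyclic_on \<pi> C} =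
    card {C. C \<subseteq> S \<and> cyclic_on \<pi> C \<and> card C > 1} + card {i\<in>S. \<pi> i = i}"
proof -
  have "{C. C \<subseteq> S \<and> cyclic_on \<pi> C} =
    {C. C \<subseteq> S \<and> cyclic_on \<pi> C \<and> card C > 1} \<union> (\<lambda>i. {i}) ` {i\<in>S. \<pi> i = i}" (is "?A = ?B \<union> ?C")
  proof (intro Set.set_eqI iffI)
    fix C assume C: "C \<in> ?A"
    then obtain x where x: "x \<in> C" "cyclic_on \<pi> C" unfolding cyclic_on_def by blast
    have "finite C" using C assms(1) finite_subset by auto
    then have "card C > 0" using x card_gt_0_iff by blast
    then consider "card C = 1" | "card C > 1" by linarith
    then show "C \<in> ?B \<union> ?C"
    proof cases
      case 1
      then obtain y where "C = {y}" by (auto simp: card_1_singleton_iff)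
      moreover from this have "orbit \<pi> y = {y}" using x(2) orbit_cyclic_eq3 by fastforce
      ultimately show ?thesis using C by (simp add: orbit_eq_singleton_iff)
    qed (use C in auto)
  qed (auto simp: cyclic_on_alldef dest: orbit_eq_singleton_iff[THEN iffD2])
  moreover have "?B \<inter> ?C = {}" by auto
  moreover have "finite ?B" "finite ?C" using assms(1) by auto
  moreover have "card ?C = card {i\<in>S. \<pi> i = i}" by (rule card_image) auto
  ultimately show ?thesis by (simp add: card_Un_disjoint)
qed

section \<open>Two-colouring for a pair of fixed-point-free involutions\<close>

text \<open>Join \<open>x\<close> to \<open>f x\<close> and to \<open>g x\<close>. Edges of the two
  kinds alternate along each component, so it is an even cycle, and \<open>C\<close> is one class of
  a proper two-colouring. Instead of following cycles, the induction deletes both ends of one edge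
  of \<open>f\<close>.\<close>

lemma involutions_common_transversal:
  fixes X :: "'a set"
  assumes "finite X"
    and "\<And>x. x \<in> X \<Longrightarrow> f x \<in> X \<and> f x \<noteq> x \<and> f (f x) = x"
    and "\<And>x. x \<in> X \<Longrightarrow> g x \<in> X \<and> g x \<noteq> x \<and> g (g x) = x"
  shows "\<exists>C\<subseteq>X. \<forall>x\<in>X. (f x \<in> C \<longleftrightarrow> x \<notin> C) \<and> (g x \<in> C \<longleftrightarrow> x \<notin> C)"
  using assms
\<comment> \<open>\<open>g\<close> is generalised because the smaller set carries a modified second
  involution.\<close>
proof (induction X arbitrary: g rule: finite_psubset_induct)
  case (psubset X)
  note f = psubset.prems(1) and g = psubset.prems(2)
  show ?case
  proof (cases "X = {}")
    case False
    then obtain x where x: "x \<in> X" by blast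
    define y where "y = f x"
    have y: "y \<in> X" "y \<noteq> x" "f y = x" using f x by (auto simp: y_def)
    \<comment> \<open>Remove the edge from \<open>x\<close> to \<open>y\<close> of \<open>f\<close> and join the two ends this leaves in \<open>g\<close>.\<close>
    define h where "h = (\<lambda>z. if g z \<noteq> x \<and> g z \<noteq> y then g z else if g z = x then g y else g x)"
    let ?Y = "X - {x, y}"
    have "\<exists>C\<subseteq>?Y. \<forall>z\<in>?Y. (f z \<in> C \<longleftrightarrow> z \<notin> C) \<and> (h z \<in> C \<longleftrightarrow> z \<notin> C)"
    proof (rule psubset.IH)
      fix z assume z: "z \<in> ?Y"
      show "f z \<in> ?Y \<and> f z \<noteq> z \<and> f (f z) = z" using f z x y by (metis Diff_iff insert_iff empty_iff y_def)
      show "h z \<in> ?Y \<and> h z \<noteq> z \<and> h (h z) = z"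
        using g[of z] g[OF x] g[OF y(1)] z y(2) unfolding h_def by (smt (verit) Diff_iff insert_iff empty_iff)
    qed (use x in auto)
    then obtain C where C: "C \<subseteq> ?Y" "\<And>z. z \<in> ?Y \<Longrightarrow> (f z \<in> C \<longleftrightarrow> z \<notin> C) \<and> (h z \<in> C \<longleftrightarrow> z \<notin> C)"
      by blast
    \<comment> \<open>Exactly one end of the removed edge joins \<open>C\<close>, chosen so that the
      edge from \<open>x\<close> along \<open>g\<close> gets two colours; if \<open>g x = y\<close>,
      either end would do.\<close>
    define D where "D = insert (if g x = y \<or> g x \<notin> C then x else y) C"
    have D: "w \<in> D \<longleftrightarrow> w \<in> C" if "w \<noteq> x" "w \<noteq> y" for w using that by (auto simp: D_def)
    have xD: "x \<in> D \<longleftrightarrow> g x = y \<or> g x \<notin> C" "y \<in> D \<longleftrightarrow> \<not> (g x = y \<or> g x \<notin> C)"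
      using C(1) y(2) by (auto simp: D_def)
    \<comment> \<open>\<open>h\<close> joins \<open>g x\<close> to \<open>g y\<close>, so these have
      opposite colours, and the choice made for \<open>x\<close> is also right at
      \<open>y\<close>.\<close>
    have key: "g x \<in> C \<longleftrightarrow> g y \<notin> C" if "g x \<noteq> y"
    proof -
      have "g y \<noteq> x" "g x \<in> ?Y" "h (g x) = g y"
        using that g[OF x] g[OF y(1)] by (auto simp: h_def)
      then show ?thesis using C(2) by metis
    qed
    have "(f z \<in> D \<longleftrightarrow> z \<notin> D) \<and> (g z \<in> D \<longleftrightarrow> z \<notin> D)" if z: "z \<in> X" for z
    proof -
      consider "z = x" | "z = y" | "z \<in> ?Y" using z by blast
      then show ?thesis
      proof cases
        case 1
        have "g x \<noteq> x" using g x by blast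
        then show ?thesis using 1 xD D[of "g x"] y_def by (cases "g x = y") auto
      next
        case 2
        have "g y \<noteq> y" "g y = x \<longleftrightarrow> g x = y" using g x y(1) by metis+
        then show ?thesis using 2 xD D[of "g y"] y(3) key by metis
      next
        case 3
        then have "f z \<noteq> x" "f z \<noteq> y" using f x y z by (metis Diff_iff insert_iff y_def)+
        moreover have "g z \<in> D \<longleftrightarrow> z \<notin> D"
        proof (cases "g z = x \<or> g z = y")
          case False
          then show ?thesis using C(2)[OF 3] D 3 by (auto simp: h_def)
        next
          case True
          then consider "z = g x" | "z = g y" using g[OF z] by metis
          then show ?thesis
          proof cases
            case 1
            then show ?thesis using True 3 xD D[of z] g[OF x] by auto
          next
            case 2
            then have "g x \<noteq> y" using 3 g[OF x] by auto
            then show ?thesis using 2 True 3 xD D[of z] g[OF y(1)] key by auto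
          qed
        qed
        ultimately show ?thesis using C(2)[OF 3] D 3 by auto
      qed
    qed
    moreover have "D \<subseteq> X" using C(1) x y by (auto simp: D_def)
    ultimately show ?thesis by blast
  qed simp
qed

section \<open>Splitting a permutation of the doubled set into two permutations\<close>

text \<open>The pair \<open>(i, b)\<close> is copy \<open>b\<close> of the index \<open>i\<close>; a set \<open>B\<close> picks the copy \<open>(i, i \<in> B)\<close> of every row.\<close>

definition select :: "('a \<times> bool \<Rightarrow> 'a \<times> bool) \<Rightarrow> 'a set \<Rightarrow> 'a \<Rightarrow> 'a" where
  "select \<tau> B i = fst (\<tau> (i, i \<in> B))"

text \<open>\<open>- B\<close> picks the opposite copy of every row. With
  \<open>B \<subseteq> S\<close>, each choice of row copies is represented by exactly one
  set.\<close>

definition splitters :: "'a set \<Rightarrow> ('a \<times> bool \<Rightarrow> 'a \<times> bool) \<Rightarrow> 'a set set" where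
  "splitters S \<tau> = {B. B \<subseteq> S \<and> select \<tau> B permutes S \<and> select \<tau> (- B) permutes S}"

text \<open>The set \<open>E\<close> decides which copy of a column is hit from the row copies picked by \<open>B\<close>.\<close>

definition merge ::
  "'a set \<Rightarrow> 'a set \<Rightarrow> 'a set \<Rightarrow> ('a \<Rightarrow> 'a) \<Rightarrow> ('a \<Rightarrow> 'a) \<Rightarrow> 'a \<times> bool \<Rightarrow> 'a \<times> bool" where
  "merge S B E \<sigma> \<rho> = (\<lambda>(i, b). if i \<in> S
     then if b = (i \<in> B) then (\<sigma> i, \<sigma> i \<in> E) else (\<rho> i, \<rho> i \<notin> E) else (i, b))"

lemma select_permutes:
  assumes "finite S" "\<tau> permutes S \<times> UNIV" "inj_on (select \<tau> B) S"
  shows "select \<tau> B permutes S"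
proof (rule inj_imp_permutes)
  fix i
  show "select \<tau> B i \<in> S" if "i \<in> S"
    using permutes_in_image[OF assms(2), of "(i, i \<in> B)"] that by (auto simp: select_def mem_Times_iff)
  show "select \<tau> B i = i" if "i \<notin> S"
    using permutes_not_in[OF assms(2), of "(i, i \<in> B)"] that by (auto simp: select_def)
qed (use assms in auto)

text \<open>\<open>f\<close> exchanges the two copies of a row, and \<open>g\<close> the two points
  sent to the same block column. A common transversal of both contains one copy of each row and one
  point over each column, and so does its complement.\<close>

lemma splitters_nonempty:
  assumes "finite S" "\<tau> permutes S \<times> (UNIV :: bool set)"
  shows "splitters S \<tau> \<noteq> {}"
proof -
  define f where "f = (\<lambda>x :: 'a \<times> bool. (fst x, \<not> snd x))"
  define g where "g = (\<lambda>x. Hilbert_Choice.inv \<tau> (f (\<tau> x)))"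
  have inverse: "Hilbert_Choice.inv \<tau> (\<tau> x) = x" "\<tau> (Hilbert_Choice.inv \<tau> x) = x" for x
    using permutes_inverses[OF assms(2)] by auto
  have mem: "\<tau> x \<in> S \<times> UNIV \<longleftrightarrow> x \<in> S \<times> UNIV" "Hilbert_Choice.inv \<tau> x \<in> S \<times> UNIV \<longleftrightarrow> x \<in> S \<times> UNIV" for x
    by (simp_all only: permutes_in_image[OF assms(2)] permutes_in_image[OF permutes_inv[OF assms(2)]])
  have f: "f x \<noteq> x" "f (f x) = x" "f x \<in> S \<times> UNIV \<longleftrightarrow> x \<in> S \<times> UNIV" for x
    by (auto simp: f_def mem_Times_iff prod_eq_iff)
  have "\<exists>C\<subseteq>S \<times> UNIV. \<forall>x\<in>S \<times> UNIV. (f x \<in> C \<longleftrightarrow> x \<notin> C) \<and> (g x \<in> C \<longleftrightarrow> x \<notin> C)"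
  proof (rule involutions_common_transversal)
    fix x assume "x \<in> S \<times> (UNIV :: bool set)"
    then show "g x \<in> S \<times> UNIV \<and> g x \<noteq> x \<and> g (g x) = x"
      using f mem inverse unfolding g_def by metis
  qed (use f assms(1) in auto)
  then obtain C where C: "\<And>x. x \<in> S \<times> UNIV \<Longrightarrow> (f x \<in> C \<longleftrightarrow> x \<notin> C) \<and> (g x \<in> C \<longleftrightarrow> x \<notin> C)"
    by blast
  \<comment> \<open>Distinct points over one column are exchanged by \<open>g\<close>, so
    \<open>C\<close> separates them; this makes both selections injective.\<close>
  have same: "x = y" if "x \<in> S \<times> UNIV" "x \<in> C \<longleftrightarrow> y \<in> C" "fst (\<tau> x) = fst (\<tau> y)" for x y
  proof (rule ccontr)
    assume "x \<noteq> y"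
    then have "\<tau> x \<noteq> \<tau> y" using inverse by metis
    then have "\<tau> y = f (\<tau> x)" using that(3) by (auto simp: f_def prod_eq_iff)
    then have "y = g x" using inverse by (simp add: g_def) metis
    then show False using C that(1,2) by blast
  qed
  define B where "B = {i \<in> S. (i, True) \<in> C}"
  have B: "(i, i \<in> B) \<in> C" "(i, i \<in> - B) \<notin> C" if "i \<in> S" for i
    using C[of "(i, True)"] that by (auto simp: B_def f_def)
  have "inj_on (select \<tau> B) S" "inj_on (select \<tau> (- B)) S"
    using same[of "(i, i \<in> B)" "(k, k \<in> B)" for i k] same[of "(i, i \<in> - B)" "(k, k \<in> - B)" for i k] B
    by (simp_all add: inj_on_def select_def)
  then have "B \<in> splitters S \<tau>"
    using select_permutes[OF assms] by (auto simp: splitters_def B_def)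
  then show ?thesis by blast
qed

text \<open>Switching the copies of the rows in \<open>D\<close> exchanges the values of the two
  selections on \<open>D\<close>. Both stay bijective exactly when the columns given up on
  \<open>D\<close> are the columns gained there.\<close>

lemma sym_diff_in_splitters_iff:
  assumes "finite S" "\<tau> permutes S \<times> (UNIV :: bool set)" "B \<in> splitters S \<tau>" "D \<subseteq> S"
  shows "sym_diff B D \<in> splitters S \<tau> \<longleftrightarrow> select \<tau> B ` D = select \<tau> (- B) ` D"
proof -
  let ?\<sigma> = "select \<tau> B" and ?\<rho> = "select \<tau> (- B)"
  let ?B = "sym_diff B D"
  have perm: "?\<sigma> permutes S" "?\<rho> permutes S" and "B \<subseteq> S"
    using assms(3) by (auto simp: splitters_def)
  have sel: "select \<tau> ?B i = (if i \<in> D then ?\<rho> i else ?\<sigma> i)"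
    "select \<tau> (- ?B) i = (if i \<in> D then ?\<sigma> i else ?\<rho> i)" for i
    by (auto simp: select_def)
  have parts: "select \<tau> ?B ` (S - D) = ?\<sigma> ` (S - D)" "select \<tau> ?B ` D = ?\<rho> ` D"
    "select \<tau> (- ?B) ` (S - D) = ?\<rho> ` (S - D)" "select \<tau> (- ?B) ` D = ?\<sigma> ` D"
    by (rule image_cong[OF refl], simp only: sel, simp)+
  have "S = (S - D) \<union> D" using assms(4) by blast
  then have img: "select \<tau> ?B ` S = ?\<sigma> ` (S - D) \<union> ?\<rho> ` D"
    "select \<tau> (- ?B) ` S = ?\<rho> ` (S - D) \<union> ?\<sigma> ` D"
    by (metis image_Un parts)+
  have diff: "?\<sigma> ` (S - D) = S - ?\<sigma> ` D" "?\<rho> ` (S - D) = S - ?\<rho> ` D"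
    using perm[THEN permutes_inj] perm[THEN permutes_image] by (simp_all add: image_set_diff)
  have sub: "?\<sigma> ` D \<subseteq> S" "?\<rho> ` D \<subseteq> S"
    using assms(4) perm[THEN permutes_image] by blast+
  show ?thesis
  proof
    assume "?B \<in> splitters S \<tau>"
    then have p: "select \<tau> ?B permutes S" by (simp add: splitters_def)
    have "?\<sigma> ` (S - D) \<inter> ?\<rho> ` D = {}"
    proof -
      have "select \<tau> ?B ` (S - D) \<inter> select \<tau> ?B ` D = {}"
        using permutes_inj[OF p] by (auto dest: injD)
      then show ?thesis by (simp only: parts)
    qed
    moreover have "?\<sigma> ` (S - D) \<union> ?\<rho> ` D = S" using permutes_image[OF p] img by simp
    \<comment> \<open>The new selection partitions \<open>S\<close> into these two images, so the
      gained columns are the complement of the kept ones.\<close>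
    ultimately have "?\<rho> ` D = S - ?\<sigma> ` (S - D)" by blast
    then show "?\<sigma> ` D = ?\<rho> ` D" using diff(1) sub(1) by (simp add: double_diff)
  next
    assume eq: "?\<sigma> ` D = ?\<rho> ` D"
    have "select \<tau> ?B ` S = S" "select \<tau> (- ?B) ` S = S"
      using img diff sub eq by auto
    then have "inj_on (select \<tau> ?B) S" "inj_on (select \<tau> (- ?B)) S"
      using assms(1) by (simp_all add: eq_card_imp_inj_on)
    then show "?B \<in> splitters S \<tau>"
      using select_permutes[OF assms(1,2)] \<open>B \<subseteq> S\<close> assms(4) by (auto simp: splitters_def)
  qed
qed

text \<open>Relative to \<open>B\<close>, a splitter is given by its difference set
  \<open>D\<close>, with equal images under both selections. Moving \<open>D\<close> to the columns
  by the second selection turns this condition into invariance under \<pi>, so the splitters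
  correspond to sets of cycles of \<pi>.\<close>

lemma card_splitters:
  assumes "finite S" "\<tau> permutes S \<times> (UNIV :: bool set)" "B \<in> splitters S \<tau>"
  defines "\<pi> \<equiv> select \<tau> B \<circ> Hilbert_Choice.inv (select \<tau> (- B))"
  shows "card (splitters S \<tau>) =
    2 ^ (card {C. C \<subseteq> S \<and> cyclic_on \<pi> C \<and> card C > 1} +
         card {i\<in>S. fst (\<tau> (i, False)) = fst (\<tau> (i, True))})"
proof -
  let ?\<sigma> = "select \<tau> B" and ?\<rho> = "select \<tau> (- B)"
  have perm: "?\<sigma> permutes S" "?\<rho> permutes S" and "B \<subseteq> S"
    using assms(3) by (auto simp: splitters_def)
  then have \<pi>: "\<pi> permutes S" by (simp add: \<pi>_def permutes_compose permutes_inv)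
  have \<pi>\<rho>: "\<pi> (?\<rho> i) = ?\<sigma> i" for i using permutes_inverses[OF perm(2)] by (simp add: \<pi>_def)
  have inv\<rho>: "?\<rho> ` Hilbert_Choice.inv ?\<rho> ` D = D" "Hilbert_Choice.inv ?\<rho> ` ?\<rho> ` D = D" for D
    using permutes_inverses[OF perm(2)] by (simp_all add: image_image)
  have \<pi>_image: "\<pi> ` ?\<rho> ` D = ?\<sigma> ` D" for D by (simp add: image_image \<pi>\<rho>)
  have sd: "sym_diff B (sym_diff B D) = D" for D by blast
  have "bij_betw (\<lambda>B'. ?\<rho> ` sym_diff B B') (splitters S \<tau>) {D. D \<subseteq> S \<and> \<pi> ` D = D}"
  proof (rule bij_betwI[where g = "\<lambda>D. sym_diff B (Hilbert_Choice.inv ?\<rho> ` D)"])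
    show "(\<lambda>B'. ?\<rho> ` sym_diff B B') \<in> splitters S \<tau> \<rightarrow> {D. D \<subseteq> S \<and> \<pi> ` D = D}"
    proof
      fix B' assume B': "B' \<in> splitters S \<tau>"
      then have sub: "sym_diff B B' \<subseteq> S" using \<open>B \<subseteq> S\<close> by (auto simp: splitters_def)
      then have "?\<sigma> ` sym_diff B B' = ?\<rho> ` sym_diff B B'"
        using sym_diff_in_splitters_iff[OF assms(1-3) sub] B' by (simp only: sd)
      moreover have "?\<rho> ` sym_diff B B' \<subseteq> S" using sub permutes_image[OF perm(2)] by blast
      ultimately show "?\<rho> ` sym_diff B B' \<in> {D. D \<subseteq> S \<and> \<pi> ` D = D}"
        by (simp only: mem_Collect_eq \<pi>_image)
    qed
    show "(\<lambda>D. sym_diff B (Hilbert_Choice.inv ?\<rho> ` D)) \<in> {D. D \<subseteq> S \<and> \<pi> ` D = D} \<rightarrow> splitters S \<tau>"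
    proof
      fix D assume D: "D \<in> {D. D \<subseteq> S \<and> \<pi> ` D = D}"
      then have sub: "Hilbert_Choice.inv ?\<rho> ` D \<subseteq> S" using permutes_image[OF permutes_inv[OF perm(2)]] by blast
      have "?\<sigma> ` Hilbert_Choice.inv ?\<rho> ` D = D" using D \<pi>_image[of "Hilbert_Choice.inv ?\<rho> ` D"] inv\<rho> by simp
      then show "sym_diff B (Hilbert_Choice.inv ?\<rho> ` D) \<in> splitters S \<tau>"
        using sym_diff_in_splitters_iff[OF assms(1-3) sub] inv\<rho> by simp
    qed
  next
    fix B'
    show "sym_diff B (Hilbert_Choice.inv ?\<rho> ` ?\<rho> ` sym_diff B B') = B'" by (simp only: inv\<rho> sd)
  next
    fix D
    show "?\<rho> ` sym_diff B (sym_diff B (Hilbert_Choice.inv ?\<rho> ` D)) = D" by (simp only: inv\<rho> sd)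
  qed
  then have "card (splitters S \<tau>) = card {D. D \<subseteq> S \<and> \<pi> ` D = D}" by (rule bij_betw_same_card)
  also have "\<dots> = card (Pow {C. C \<subseteq> S \<and> cyclic_on \<pi> C})"
    using bij_betw_same_card[OF bij_betw_Union_cyclic_invariant[OF assms(1) \<pi>]] by simp
  also have "\<dots> = 2 ^ card {C. C \<subseteq> S \<and> cyclic_on \<pi> C}"
    using assms(1) by (simp add: card_Pow)
  \<comment> \<open>A fixed point of \<pi> is a column on which both selections agree for the same
    row, that is, one hit by both copies of that row.\<close>
  also have "card {i\<in>S. \<pi> i = i} = card {i\<in>S. fst (\<tau> (i, False)) = fst (\<tau> (i, True))}"
  proof -
    have "?\<sigma> i = ?\<rho> i \<longleftrightarrow> fst (\<tau> (i, False)) = fst (\<tau> (i, True))" for i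
      by (cases "i \<in> B") (auto simp: select_def)
    then have "?\<rho> ` {i\<in>S. fst (\<tau> (i, False)) = fst (\<tau> (i, True))} = ?\<rho> ` {i\<in>S. \<pi> (?\<rho> i) = ?\<rho> i}"
      by (simp add: \<pi>\<rho>)
    also have "\<dots> = {i\<in>?\<rho> ` S. \<pi> i = i}" by (rule Compr_image_eq[symmetric])
    also have "\<dots> = {i\<in>S. \<pi> i = i}" by (simp only: permutes_image[OF perm(2)])
    finally have "card {i\<in>S. \<pi> i = i} = card (?\<rho> ` {i\<in>S. fst (\<tau> (i, False)) = fst (\<tau> (i, True))})"
      by (simp only:)
    also have "\<dots> = card {i\<in>S. fst (\<tau> (i, False)) = fst (\<tau> (i, True))}"
      by (rule card_image[OF permutes_inj_on[OF perm(2)]])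
    finally show ?thesis .
  qed
  then have "card {C. C \<subseteq> S \<and> cyclic_on \<pi> C} = card {C. C \<subseteq> S \<and> cyclic_on \<pi> C \<and> card C > 1} +
         card {i\<in>S. fst (\<tau> (i, False)) = fst (\<tau> (i, True))}"
    using card_cyclic_subsets[OF assms(1) \<pi>] by simp
  finally show ?thesis .
qed

lemma select_merge:
  assumes "\<sigma> permutes S" "\<rho> permutes S"
  shows "select (merge S B E \<sigma> \<rho>) B = \<sigma>" "select (merge S B E \<sigma> \<rho>) (- B) = \<rho>"
  using assms by (auto simp: select_def merge_def fun_eq_iff permutes_not_in)

text \<open>Each column is hit once from either half of the row copies, and the two hits use
  opposite copies of it.\<close>

lemma merge_permutes:
  assumes "finite S" "\<sigma> permutes S" "\<rho> permutes S"
  shows "merge S B E \<sigma> \<rho> permutes S \<times> UNIV"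
proof (rule inj_imp_permutes)
  show "inj_on (merge S B E \<sigma> \<rho>) (S \<times> UNIV)"
    using assms(2,3)[THEN permutes_inj]
    by (auto intro!: inj_onI simp: merge_def inj_eq split: if_splits)
  show "merge S B E \<sigma> \<rho> x \<in> S \<times> UNIV" if "x \<in> S \<times> UNIV" for x
    using that permutes_in_image[OF assms(2)] permutes_in_image[OF assms(3)]
    by (auto simp: merge_def)
qed (use assms(1) in \<open>auto simp: merge_def split: if_splits\<close>)

text \<open>For fixed \<open>B\<close>, the two selections and the column copies hit from the picked
  half determine \<tau>: by injectivity the other half must hit the remaining copies. So each pair
  of permutations comes from \<open>2 ^ card S\<close> choices of \<tau>.\<close>

lemma bij_betw_merge:
  assumes "finite S" "B \<subseteq> S"
  shows "bij_betw (\<lambda>((\<sigma>, \<rho>), E). merge S B E \<sigma> \<rho>)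
    (({\<sigma>. \<sigma> permutes S} \<times> {\<rho>. \<rho> permutes S}) \<times> Pow S)
    {\<tau>. \<tau> permutes S \<times> UNIV \<and> B \<in> splitters S \<tau>}"
    (is "bij_betw ?F _ _")
\<comment> \<open>\<open>E\<close> is recovered as the set of columns whose \<open>True\<close> copy
  is hit by a picked row copy.\<close>
proof (rule bij_betwI[where g = "\<lambda>\<tau>. ((select \<tau> B, select \<tau> (- B)), select \<tau> B ` {i \<in> S. snd (\<tau> (i, i \<in> B))})"])
  show "(\<lambda>((\<sigma>, \<rho>), E). merge S B E \<sigma> \<rho>) \<in> ({\<sigma>. \<sigma> permutes S} \<times> {\<rho>. \<rho> permutes S}) \<times> Pow S
      \<rightarrow> {\<tau>. \<tau> permutes S \<times> UNIV \<and> B \<in> splitters S \<tau>}"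
    using assms by (auto simp: merge_permutes splitters_def select_merge)
  show "(\<lambda>\<tau>. ((select \<tau> B, select \<tau> (- B)), select \<tau> B ` {i \<in> S. snd (\<tau> (i, i \<in> B))}))
      \<in> {\<tau>. \<tau> permutes S \<times> UNIV \<and> B \<in> splitters S \<tau>}
      \<rightarrow> ({\<sigma>. \<sigma> permutes S} \<times> {\<rho>. \<rho> permutes S}) \<times> Pow S"
    by (auto simp: splitters_def permutes_in_image)
next
  fix x assume "x \<in> ({\<sigma>. \<sigma> permutes S} \<times> {\<rho>. \<rho> permutes S}) \<times> Pow S"
  then obtain \<sigma> \<rho> E where x: "x = ((\<sigma>, \<rho>), E)" "\<sigma> permutes S" "\<rho> permutes S" "E \<subseteq> S" by auto
  have "\<sigma> ` {i \<in> S. snd (merge S B E \<sigma> \<rho> (i, i \<in> B))} = \<sigma> ` {i \<in> S. \<sigma> i \<in> E}"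
    by (auto simp: merge_def)
  also have "\<dots> = \<sigma> ` S \<inter> E" by blast
  also have "\<dots> = E" using x(4) by (simp add: permutes_image[OF x(2)] Int_absorb1)
  finally show "((select (?F x) B, select (?F x) (- B)), select (?F x) B ` {i \<in> S. snd (?F x (i, i \<in> B))}) = x"
    using x by (simp add: select_merge)
next
  fix \<tau> assume "\<tau> \<in> {\<tau>. \<tau> permutes S \<times> (UNIV :: bool set) \<and> B \<in> splitters S \<tau>}"
  then have \<tau>: "\<tau> permutes S \<times> UNIV"
    and perm: "select \<tau> B permutes S" "select \<tau> (- B) permutes S"
    by (auto simp: splitters_def)
  define E where "E = select \<tau> B ` {i \<in> S. snd (\<tau> (i, i \<in> B))}"
  have E: "select \<tau> B i \<in> E \<longleftrightarrow> snd (\<tau> (i, i \<in> B))" if "i \<in> S" for i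
    using that permutes_inj[OF perm(1)] by (auto simp: E_def inj_eq)
  have "merge S B E (select \<tau> B) (select \<tau> (- B)) (i, b) = \<tau> (i, b)" for i b
  proof (cases "i \<in> S")
    case False
    then show ?thesis using permutes_not_in[OF \<tau>, of "(i, b)"] by (simp add: merge_def)
  next
    case True
    show ?thesis
    proof (cases "b = (i \<in> B)")
      case b: True
      then show ?thesis using True E by (simp add: merge_def) (simp add: select_def)
    next
      case b: False
      have "select \<tau> (- B) i \<in> select \<tau> B ` S"
        using permutes_image[OF perm(1)] permutes_in_image[OF perm(2)] True by simp
      \<comment> \<open>\<open>k\<close> is the row whose picked copy reaches the same column;
        injectivity of \<tau> forces it onto the other copy.\<close>
      then obtain k where k: "k \<in> S" "select \<tau> (- B) i = select \<tau> B k" by blast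
      have "\<tau> (i, b) \<noteq> \<tau> (k, k \<in> B)"
        using permutes_inj[OF \<tau>] b by (auto simp: inj_eq)
      moreover have fst: "fst (\<tau> (i, b)) = select \<tau> (- B) i" using b by (auto simp: select_def)
      ultimately have "snd (\<tau> (i, b)) \<longleftrightarrow> \<not> snd (\<tau> (k, k \<in> B))"
        using k by (auto simp: select_def prod_eq_iff)
      then have "snd (\<tau> (i, b)) \<longleftrightarrow> select \<tau> (- B) i \<notin> E" using E[OF k(1)] k(2) by simp
      then show ?thesis using True b fst by (simp add: merge_def prod_eq_iff)
    qed
  qed
  then show "(\<lambda>((\<sigma>, \<rho>), E). merge S B E \<sigma> \<rho>)
      ((select \<tau> B, select \<tau> (- B)), select \<tau> B ` {i \<in> S. snd (\<tau> (i, i \<in> B))}) = \<tau>"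
    by (auto simp: E_def)
qed

section \<open>Double counting of permutations with a splitting\<close>

text \<open>Both sides sum the weight \<open>w\<close> over pairs of \<tau> and a splitter
  \<open>B\<close>. Grouped by \<tau>, the number of splitters cancels the power of two in
  \<open>w\<close> and leaves the factor for coinciding columns. Grouped by \<open>B\<close>, there
  are \<open>2 ^ card S\<close> sets and as many \<tau> for each pair of permutations.\<close>

lemma sum_permutes_double_cover:
  fixes a :: "'a \<Rightarrow> 'a \<Rightarrow> real"
  assumes "finite S"
  shows "(\<Sum>\<tau> | \<tau> permutes S \<times> (UNIV :: bool set).
      (\<Prod>x\<in>S \<times> UNIV. a (fst x) (fst (\<tau> x))) *
      2 ^ card {i\<in>S. fst (\<tau> (i, False)) = fst (\<tau> (i, True))}) =
    4 ^ card S * (\<Sum>\<sigma> | \<sigma> permutes S. \<Sum>\<rho> | \<rho> permutes S.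
      (\<Prod>i\<in>S. a i (\<sigma> i)) * (\<Prod>i\<in>S. a i (\<rho> i)) /
      2 ^ card {C. C \<subseteq> S \<and> cyclic_on (\<sigma> \<circ> Hilbert_Choice.inv \<rho>) C \<and> card C > 1})"
proof -
  define T :: "('a \<times> bool \<Rightarrow> 'a \<times> bool) set" where "T = {\<tau>. \<tau> permutes S \<times> UNIV}"
  define R where "R = {\<sigma>. \<sigma> permutes S}"
  define w where "w = (\<lambda>\<sigma> \<rho>. (\<Prod>i\<in>S. a i (\<sigma> i)) * (\<Prod>i\<in>S. a i (\<rho> i)) /
      2 ^ card {C. C \<subseteq> S \<and> cyclic_on (\<sigma> \<circ> Hilbert_Choice.inv \<rho>) C \<and> card C > 1})"
  have fin: "finite T" "finite (Pow S)" "finite R"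
    using assms by (auto simp: T_def R_def intro!: finite_permutations)
  have "(\<Sum>\<tau>\<in>T. (\<Prod>x\<in>S \<times> UNIV. a (fst x) (fst (\<tau> x))) *
      2 ^ card {i\<in>S. fst (\<tau> (i, False)) = fst (\<tau> (i, True))}) =
    (\<Sum>\<tau>\<in>T. \<Sum>B | B \<in> Pow S \<and> B \<in> splitters S \<tau>. w (select \<tau> B) (select \<tau> (- B)))"
  proof (rule sum.cong[OF refl])
    fix \<tau> assume "\<tau> \<in> T"
    then have \<tau>: "\<tau> permutes S \<times> UNIV" by (simp add: T_def)
    let ?W = "(\<Prod>x\<in>S \<times> UNIV. a (fst x) (fst (\<tau> x))) *
      2 ^ card {i\<in>S. fst (\<tau> (i, False)) = fst (\<tau> (i, True))}"
    \<comment> \<open>The weight is the same for every splitter: the two selections together use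
      each row copy once, and the cycle count is fixed by the number of splitters.\<close>
    have "w (select \<tau> B) (select \<tau> (- B)) = ?W / real (card (splitters S \<tau>))"
      if B: "B \<in> splitters S \<tau>" for B
    proof -
      have "(\<Prod>x\<in>S \<times> UNIV. a (fst x) (fst (\<tau> x))) =
          (\<Prod>i\<in>S. \<Prod>b\<in>UNIV. a i (fst (\<tau> (i, b))))"
        by (subst prod.cartesian_product) (simp add: case_prod_beta)
      also have "\<dots> = (\<Prod>i\<in>S. a i (select \<tau> B i) * a i (select \<tau> (- B) i))"
        by (rule prod.cong[OF refl], rename_tac i, case_tac "i \<in> B") (simp_all add: UNIV_bool select_def)
      finally show ?thesis
        unfolding card_splitters[OF assms \<tau> B] w_def by (simp add: prod.distrib power_add)
    qed
    moreover have "{B. B \<in> Pow S \<and> B \<in> splitters S \<tau>} = splitters S \<tau>"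
      by (auto simp: splitters_def)
    moreover have "card (splitters S \<tau>) \<noteq> 0"
    proof -
      have "finite (splitters S \<tau>)"
        using fin(2) by (rule rev_finite_subset) (auto simp: splitters_def)
      then show ?thesis using splitters_nonempty[OF assms \<tau>] by simp
    qed
    ultimately show "?W = (\<Sum>B | B \<in> Pow S \<and> B \<in> splitters S \<tau>. w (select \<tau> B) (select \<tau> (- B)))"
      by simp
  qed
  also have "\<dots> = (\<Sum>B\<in>Pow S. \<Sum>\<tau> | \<tau> \<in> T \<and> B \<in> splitters S \<tau>. w (select \<tau> B) (select \<tau> (- B)))"
    by (rule sum.swap_restrict[OF fin(1,2)])
  also have "\<dots> = (\<Sum>B\<in>Pow S. 2 ^ card S * (\<Sum>\<sigma>\<in>R. \<Sum>\<rho>\<in>R. w \<sigma> \<rho>))"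
  proof (rule sum.cong[OF refl])
    fix B assume "B \<in> Pow S"
    then have "B \<subseteq> S" by simp
    have "(\<Sum>\<tau> | \<tau> \<in> T \<and> B \<in> splitters S \<tau>. w (select \<tau> B) (select \<tau> (- B))) =
      (\<Sum>((\<sigma>, \<rho>), E)\<in>(R \<times> R) \<times> Pow S. w (select (merge S B E \<sigma> \<rho>) B) (select (merge S B E \<sigma> \<rho>) (- B)))"
      using sum.reindex_bij_betw[OF bij_betw_merge[OF assms \<open>B \<subseteq> S\<close>],
        of "\<lambda>\<tau>. w (select \<tau> B) (select \<tau> (- B))", symmetric]
      by (simp add: T_def R_def case_prod_beta)
    also have "\<dots> = (\<Sum>((\<sigma>, \<rho>), E)\<in>(R \<times> R) \<times> Pow S. w \<sigma> \<rho>)"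
      by (rule sum.cong) (auto simp: R_def select_merge)
    also have "\<dots> = (\<Sum>(\<sigma>, \<rho>)\<in>R \<times> R. 2 ^ card S * w \<sigma> \<rho>)"
      using assms by (subst sum.cartesian_product[symmetric]) (simp add: case_prod_beta card_Pow)
    also have "\<dots> = 2 ^ card S * (\<Sum>\<sigma>\<in>R. \<Sum>\<rho>\<in>R. w \<sigma> \<rho>)"
      by (simp add: sum.cartesian_product sum_distrib_left case_prod_beta)
    finally show "(\<Sum>\<tau> | \<tau> \<in> T \<and> B \<in> splitters S \<tau>. w (select \<tau> B) (select \<tau> (- B))) =
      2 ^ card S * (\<Sum>\<sigma>\<in>R. \<Sum>\<rho>\<in>R. w \<sigma> \<rho>)" .
  qed
  also have "\<dots> = 4 ^ card S * (\<Sum>\<sigma>\<in>R. \<Sum>\<rho>\<in>R. w \<sigma> \<rho>)"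
    using assms by (simp add: card_Pow flip: power_mult_distrib)
  finally show ?thesis by (simp add: T_def R_def w_def)
qed

section \<open>The lifted permanent over the doubled index set\<close>

text \<open>Conjugation by \<open>h\<close> carries the permutations of \<open>T\<close> to those of
  \<open>S\<close>; the conditional inside the proof extends the conjugate by the identity outside
  \<open>S\<close>.\<close>

lemma sum_permutes_reindex:
  assumes "bij_betw h T S"
  shows "(\<Sum>\<sigma> | \<sigma> permutes S. \<Prod>i\<in>S. f i (\<sigma> i)) =
    (\<Sum>\<tau> | \<tau> permutes T. \<Prod>x\<in>T. f (h x) (h (\<tau> x)) :: 'a :: comm_semiring_1)"
proof -
  have "(\<Sum>\<sigma> | \<sigma> permutes S. \<Prod>i\<in>S. f i (\<sigma> i)) =
    (\<Sum>\<tau> | \<tau> permutes T. \<Prod>i\<in>S. f i (if i \<in> S then h (\<tau> (inv_into T h i)) else i))"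
    by (rule sum.reindex_bij_betw[OF bij_betw_permutations[OF assms], symmetric])
  also have "\<dots> = (\<Sum>\<tau> | \<tau> permutes T. \<Prod>x\<in>T. f (h x) (h (\<tau> x)))"
  proof (rule sum.cong[OF refl])
    fix \<tau>
    have "(\<Prod>i\<in>S. f i (if i \<in> S then h (\<tau> (inv_into T h i)) else i)) =
      (\<Prod>x\<in>T. f (h x) (if h x \<in> S then h (\<tau> (inv_into T h (h x))) else h x))"
      by (rule prod.reindex_bij_betw[OF assms, symmetric])
    also have "\<dots> = (\<Prod>x\<in>T. f (h x) (h (\<tau> x)))"
      using assms by (intro prod.cong) (auto simp: bij_betw_def)
    finally show "(\<Prod>i\<in>S. f i (if i \<in> S then h (\<tau> (inv_into T h i)) else i)) =
      (\<Prod>x\<in>T. f (h x) (h (\<tau> x)))" .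
  qed
  finally show ?thesis .
qed

text \<open>This matches the layout of \<open>lift_matrix\<close>: the quotient by 2 is the block
  and the parity is the copy, odd being \<open>True\<close>.\<close>

lemma bij_betw_double_index:
  "bij_betw (\<lambda>x. 2 * fst x + of_bool (snd x)) ({0..<n} \<times> UNIV) {0..<2 * n :: nat}"
  by (rule bij_betwI[where g = "\<lambda>k. (k div 2, odd k)"]) auto

lemma permanent_lift_matrix_2:
  assumes "A \<in> carrier_mat n n" "P \<in> perm_matrix_families n 2"
  shows "permanent (lift_matrix 2 A P) =
    (\<Sum>\<tau> | \<tau> permutes {0..<n} \<times> UNIV. \<Prod>x\<in>{0..<n} \<times> UNIV.
      A $$ (fst x, fst (\<tau> x)) *
      P (fst x, fst (\<tau> x)) $$ (of_bool (snd x), of_bool (snd (\<tau> x))))"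
proof -
  let ?h = "\<lambda>x. 2 * fst x + of_bool (snd x) :: nat"
  have "permanent (lift_matrix 2 A P) =
    (\<Sum>\<sigma> | \<sigma> permutes {0..<2 * n}. \<Prod>r = 0..<2 * n. lift_matrix 2 A P $$ (r, \<sigma> r))"
    using assms by (simp add: permanent_def lift_matrix_def)
  also have "\<dots> = (\<Sum>\<tau> | \<tau> permutes {0..<n} \<times> (UNIV :: bool set). \<Prod>x\<in>{0..<n} \<times> UNIV.
      lift_matrix 2 A P $$ (?h x, ?h (\<tau> x)))"
    by (rule sum_permutes_reindex[OF bij_betw_double_index])
  also have "\<dots> = (\<Sum>\<tau> | \<tau> permutes {0..<n} \<times> UNIV. \<Prod>x\<in>{0..<n} \<times> UNIV.
      A $$ (fst x, fst (\<tau> x)) *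
      P (fst x, fst (\<tau> x)) $$ (of_bool (snd x), of_bool (snd (\<tau> x))))"
  proof (intro sum.cong prod.cong refl)
    fix \<tau> and x :: "nat \<times> bool"
    assume "\<tau> \<in> {\<tau>. \<tau> permutes {0..<n} \<times> (UNIV :: bool set)}" and x: "x \<in> {0..<n} \<times> UNIV"
    then have "\<tau> x \<in> {0..<n} \<times> UNIV" by (simp add: permutes_in_image)
    moreover have "?h y < 2 * n" "?h y div 2 = fst y" "?h y mod 2 = of_bool (snd y)"
      if "y \<in> {0..<n} \<times> UNIV" for y
      using that by auto
    \<comment> \<open>The block dimensions are needed to read an entry of the scalar multiple of a
      block.\<close>
    moreover have "dim_row (P (i, j)) = 2 \<and> dim_col (P (i, j)) = 2" if "i < n" "j < n" for i j
    proof -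
      have "P (i, j) \<in> perm_matrices 2"
        using assms(2) that by (auto simp: perm_matrix_families_def)
      then show ?thesis by (auto simp: perm_matrices_def)
    qed
    ultimately show "lift_matrix 2 A P $$ (?h x, ?h (\<tau> x)) = A $$ (fst x, fst (\<tau> x)) *
        P (fst x, fst (\<tau> x)) $$ (of_bool (snd x), of_bool (snd (\<tau> x)))"
      using assms(1) x by (auto simp: lift_matrix_def mem_Times_iff)
  qed
  finally show ?thesis .
qed

section \<open>Averaging over families of 2 by 2 permutation matrices\<close>

text \<open>\<open>True\<close> encodes the identity and \<open>False\<close> the exchange
  matrix.\<close>

definition bool_matrix :: "bool \<Rightarrow> real mat" where
  "bool_matrix d = mat 2 2 (\<lambda>(k, l). if (l = k) = d then 1 else 0)"

lemma bij_betw_bool_matrix: "bij_betw bool_matrix UNIV (perm_matrices 2)"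
proof -
  have "perm_matrices 2 = {bool_matrix True, bool_matrix False}"
  proof -
    have "{0..<2} = {0, 1 :: nat}" by auto
    then have "{\<sigma>. \<sigma> permutes {0..<2}} = {id, Transposition.transpose 0 (1 :: nat)}"
      by (auto simp: permutes_doubleton_iff)
    then have "perm_matrices 2 = (\<lambda>\<sigma>. mat 2 2 (\<lambda>(k, l). if l = \<sigma> k then 1 else 0)) `
        {id, Transposition.transpose 0 (1 :: nat)}"
      unfolding perm_matrices_def by blast
    moreover have "mat 2 2 (\<lambda>(k, l). if l = id k then 1 else 0) = bool_matrix True"
      by (simp add: bool_matrix_def)
    moreover have "mat 2 2 (\<lambda>(k, l). if l = Transposition.transpose 0 (1 :: nat) k then 1 else 0) = bool_matrix False"
      by (rule eq_matI) (auto simp: bool_matrix_def less_2_cases_iff)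
    ultimately show ?thesis by simp
  qed
  moreover have "bool_matrix True \<noteq> bool_matrix False"
    by (auto simp: bool_matrix_def dest: arg_cong[where f = "\<lambda>p. p $$ (0, 0)"])
  ultimately show ?thesis by (auto simp: bij_betw_def inj_on_def UNIV_bool)
qed

lemma card_perm_matrix_families_2: "card (perm_matrix_families n 2) = 2 ^ (n * n)"
  using bij_betw_same_card[OF bij_betw_bool_matrix]
  by (simp add: perm_matrix_families_def card_PiE)

text \<open>One or two factors 2 are missing, according to whether \<open>j = k\<close>; the factor
  4 avoids subtraction in the exponent.\<close>

lemma prod_two_points:
  assumes "finite S" "j \<in> S" "k \<in> S"
  shows "4 * (\<Prod>l\<in>S. if l = j \<or> l = k then 1 else 2) = 2 ^ card S * (if j = k then 2 else 1 :: real)"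
proof -
  have "2 ^ card S = (\<Prod>l\<in>S. 2 :: real)" by simp
  \<comment> \<open>The missing factors 2 are split off at \<open>j\<close> and at \<open>k\<close>;
    the inner test on \<open>j = k\<close> keeps a single point from counting twice.\<close>
  also have "\<dots> = (\<Prod>l\<in>S. (if l = j \<or> l = k then 1 else 2) *
      ((if l = j then 2 else 1) * (if l = k then if j = k then 1 else 2 else 1)))"
    by (rule prod.cong) auto
  also have "\<dots> = (\<Prod>l\<in>S. if l = j \<or> l = k then 1 else 2) * (2 * (if j = k then 1 else 2))"
    unfolding prod.distrib using assms by (simp add: prod.delta)
  finally have "2 ^ card S = (\<Prod>l\<in>S. if l = j \<or> l = k then 1 else 2) * (2 * (if j = k then 1 else 2 :: real))" .
  then show ?thesis by (simp only:) simp
qed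

text \<open>Blocks are chosen independently, so the sum factors over blocks. A block that \<tau>
  does not meet contributes 2, and one that it meets contributes 1, since exactly one of the two
  matrices has ones at all the required entries. Each block row meets one or two blocks.\<close>

lemma sum_families_prod:
  assumes "\<tau> permutes {0..<n} \<times> UNIV"
  shows "4 ^ n * (\<Sum>P\<in>perm_matrix_families n 2. \<Prod>x\<in>{0..<n} \<times> UNIV.
      P (fst x, fst (\<tau> x)) $$ (of_bool (snd x), of_bool (snd (\<tau> x)))) =
    2 ^ (n * n) * 2 ^ card {i\<in>{0..<n}. fst (\<tau> (i, False)) = fst (\<tau> (i, True))}"
proof -
  let ?S = "{0..<n}"
  \<comment> \<open>The contribution of one block: the entries of \<open>p\<close> read by those row
    copies that \<tau> sends into it, and 1 if there are none.\<close>
  define h where "h = (\<lambda>ij p. \<Prod>b\<in>UNIV. if fst (\<tau> (fst ij, b)) = snd ij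
    then p $$ (of_bool b, of_bool (snd (\<tau> (fst ij, b)))) else (1 :: real))"
  have mem: "fst (\<tau> (i, b)) \<in> ?S" if "i \<in> ?S" for i b
    using permutes_in_image[OF assms, of "(i, b)"] that by (auto simp: mem_Times_iff)
  have "(\<Prod>x\<in>?S \<times> UNIV. P (fst x, fst (\<tau> x)) $$ (of_bool (snd x), of_bool (snd (\<tau> x)))) =
    (\<Prod>ij\<in>?S \<times> ?S. h ij (P ij))" for P
  proof -
    have "(\<Prod>x\<in>?S \<times> UNIV. P (fst x, fst (\<tau> x)) $$ (of_bool (snd x), of_bool (snd (\<tau> x)))) =
      (\<Prod>i\<in>?S. \<Prod>b\<in>UNIV. P (i, fst (\<tau> (i, b))) $$ (of_bool b, of_bool (snd (\<tau> (i, b)))))"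
      by (subst prod.cartesian_product) (simp add: case_prod_beta)
    \<comment> \<open>A product with a single nontrivial factor introduces the block column as an
      index, so that the entries can be regrouped by block.\<close>
    also have "\<dots> = (\<Prod>i\<in>?S. \<Prod>b\<in>UNIV. \<Prod>j\<in>?S. if fst (\<tau> (i, b)) = j
        then P (i, j) $$ (of_bool b, of_bool (snd (\<tau> (i, b)))) else 1)"
      using mem by (intro prod.cong refl) (simp add: prod.delta')
    also have "\<dots> = (\<Prod>i\<in>?S. \<Prod>j\<in>?S. h (i, j) (P (i, j)))"
      unfolding h_def fst_conv snd_conv by (rule prod.cong[OF refl], rule prod.swap)
    also have "\<dots> = (\<Prod>ij\<in>?S \<times> ?S. h ij (P ij))"
      by (simp add: prod.cartesian_product)
    finally show ?thesis .
  qed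
  then have "(\<Sum>P\<in>perm_matrix_families n 2. \<Prod>x\<in>?S \<times> UNIV.
      P (fst x, fst (\<tau> x)) $$ (of_bool (snd x), of_bool (snd (\<tau> x)))) =
    (\<Sum>P\<in>perm_matrix_families n 2. \<Prod>ij\<in>?S \<times> ?S. h ij (P ij))"
    by simp
  also have "\<dots> = (\<Prod>ij\<in>?S \<times> ?S. \<Sum>p\<in>perm_matrices 2. h ij p)"
    unfolding perm_matrix_families_def
    using bij_betw_finite[OF bij_betw_bool_matrix] by (intro prod_sum_PiE[symmetric]) auto
  also have "\<dots> = (\<Prod>i\<in>?S. \<Prod>j\<in>?S. \<Sum>p\<in>perm_matrices 2. h (i, j) p)"
    by (simp add: prod.cartesian_product)
  also have "\<dots> = (\<Prod>i\<in>?S. \<Prod>j\<in>?S. if j = fst (\<tau> (i, False)) \<or> j = fst (\<tau> (i, True)) then 1 else 2)"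
  proof (intro prod.cong refl)
    fix i j
    \<comment> \<open>If both copies of a row enter the same block, they read different columns of
      it, so their two conditions are met by the same matrix.\<close>
    have "\<tau> (i, False) \<noteq> \<tau> (i, True)" using permutes_inj[OF assms] by (simp add: inj_eq)
    then have "fst (\<tau> (i, False)) = fst (\<tau> (i, True)) \<Longrightarrow> snd (\<tau> (i, False)) \<noteq> snd (\<tau> (i, True))"
      by (simp add: prod_eq_iff)
    moreover have "(\<Sum>p\<in>perm_matrices 2. h (i, j) p) = h (i, j) (bool_matrix False) + h (i, j) (bool_matrix True)"
      using sum.reindex_bij_betw[OF bij_betw_bool_matrix, of "h (i, j)"] by (simp add: UNIV_bool)
    moreover have "bool_matrix d $$ (0, 0) = of_bool d" "bool_matrix d $$ (0, Suc 0) = of_bool (\<not> d)"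
      "bool_matrix d $$ (Suc 0, 0) = of_bool (\<not> d)" "bool_matrix d $$ (Suc 0, Suc 0) = of_bool d" for d
      by (simp_all add: bool_matrix_def)
    ultimately show "(\<Sum>p\<in>perm_matrices 2. h (i, j) p) =
      (if j = fst (\<tau> (i, False)) \<or> j = fst (\<tau> (i, True)) then 1 else 2)"
      by (auto simp: h_def UNIV_bool)
  qed
  finally have "4 ^ n * (\<Sum>P\<in>perm_matrix_families n 2. \<Prod>x\<in>?S \<times> UNIV.
      P (fst x, fst (\<tau> x)) $$ (of_bool (snd x), of_bool (snd (\<tau> x)))) =
    (\<Prod>i\<in>?S. 4 * (\<Prod>j\<in>?S. if j = fst (\<tau> (i, False)) \<or> j = fst (\<tau> (i, True)) then 1 else 2))"
    by (simp add: prod.distrib)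
  also have "\<dots> = (\<Prod>i\<in>?S. 2 ^ n * (if fst (\<tau> (i, False)) = fst (\<tau> (i, True)) then 2 else 1))"
    using mem prod_two_points[of ?S] by (intro prod.cong refl) simp
  also have "\<dots> = 2 ^ (n * n) * 2 ^ card {i\<in>?S. fst (\<tau> (i, False)) = fst (\<tau> (i, True))}"
    unfolding prod.distrib prod.inter_filter[OF finite_atLeastLessThan, symmetric]
    by (simp add: power_mult)
  finally show ?thesis .
qed

section \<open>Evaluation of the degree-2 Bethe permanent\<close>

text \<open>Summing over families first leaves the weighted sum over \<tau>. The two factors
  \<open>4 ^ n\<close>, from the family sum and from the double counting, cancel, and
  \<open>2 ^ (n * n)\<close> is the number of families.\<close>

lemma bethe_permanent_2:
  assumes "A \<in> carrier_mat n n"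
  shows "bethe_permanent 2 A =
    sqrt (\<Sum>\<sigma> | \<sigma> permutes {0..<n}. \<Sum>\<rho> | \<rho> permutes {0..<n}.
      (\<Prod>i = 0..<n. A $$ (i, \<sigma> i)) * (\<Prod>i = 0..<n. A $$ (i, \<rho> i)) / 2 ^ cycle_count n \<sigma> \<rho>)"
    (is "_ = sqrt ?R")
proof -
  let ?T = "{\<tau>. \<tau> permutes {0..<n} \<times> (UNIV :: bool set)}"
  let ?F = "perm_matrix_families n 2"
  let ?a = "\<lambda>\<tau>. \<Prod>x\<in>{0..<n} \<times> UNIV. A $$ (fst x, fst (\<tau> x))"
  let ?b = "\<lambda>P \<tau>. \<Prod>x\<in>{0..<n} \<times> UNIV. P (fst x, fst (\<tau> x)) $$ (of_bool (snd x), of_bool (snd (\<tau> x)))"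
  have "4 ^ n * (\<Sum>P\<in>?F. permanent (lift_matrix 2 A P)) = 4 ^ n * (\<Sum>P\<in>?F. \<Sum>\<tau>\<in>?T. ?a \<tau> * ?b P \<tau>)"
    by (simp add: permanent_lift_matrix_2[OF assms] prod.distrib)
  also have "\<dots> = (\<Sum>\<tau>\<in>?T. ?a \<tau> * (4 ^ n * (\<Sum>P\<in>?F. ?b P \<tau>)))"
    by (subst sum.swap) (simp add: sum_distrib_left mult_ac)
  also have "\<dots> = 2 ^ (n * n) * (\<Sum>\<tau>\<in>?T. ?a \<tau> * 2 ^ card {i\<in>{0..<n}. fst (\<tau> (i, False)) = fst (\<tau> (i, True))})"
    unfolding sum_distrib_left
    by (intro sum.cong refl) (simp add: sum_families_prod flip: sum_distrib_left)
  also have "\<dots> = 2 ^ (n * n) * (4 ^ n * ?R)"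
    by (subst sum_permutes_double_cover) (simp_all add: cycle_count_def nontrivial_cycles_def)
  finally have "(\<Sum>P\<in>?F. permanent (lift_matrix 2 A P)) = 2 ^ (n * n) * ?R"
    by simp
  then show ?thesis
    using assms by (simp add: bethe_permanent_def card_perm_matrix_families_2 sqrt_def)
qed

theorem proposition2:
  fixes n :: nat and A :: "real mat"
  assumes "n > 0"
    and "A \<in> carrier_mat n n"
    and "\<And>i j. i < n \<Longrightarrow> j < n \<Longrightarrow> A $$ (i, j) \<ge> 0"
    and "permanent A > 0"
  shows "bethe_permanent 2 A / permanent A =
    sqrt (\<Sum>\<sigma>1 | \<sigma>1 permutes {0..<n}. \<Sum>\<sigma>2 | \<sigma>2 permutes {0..<n}.
      perm_pmf A \<sigma>1 * perm_pmf A \<sigma>2 * 2 powi (- int (cycle_count n \<sigma>1 \<sigma>2)))"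
proof -
  let ?w = "\<lambda>\<sigma> \<rho>. (\<Prod>i = 0..<n. A $$ (i, \<sigma> i)) * (\<Prod>i = 0..<n. A $$ (i, \<rho> i)) / 2 ^ cycle_count n \<sigma> \<rho>"
  have "perm_pmf A \<sigma> * perm_pmf A \<rho> * 2 powi (- int (cycle_count n \<sigma> \<rho>)) = ?w \<sigma> \<rho> / (permanent A)\<^sup>2" for \<sigma> \<rho>
    using assms(2) by (simp add: perm_pmf_def power_int_minus power2_eq_square field_simps)
  then have "sqrt (\<Sum>\<sigma>1 | \<sigma>1 permutes {0..<n}. \<Sum>\<sigma>2 | \<sigma>2 permutes {0..<n}.
      perm_pmf A \<sigma>1 * perm_pmf A \<sigma>2 * 2 powi (- int (cycle_count n \<sigma>1 \<sigma>2))) =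
    sqrt ((\<Sum>\<sigma> | \<sigma> permutes {0..<n}. \<Sum>\<rho> | \<rho> permutes {0..<n}. ?w \<sigma> \<rho>) / (permanent A)\<^sup>2)"
    by (simp add: sum_divide_distrib)
  \<comment> \<open>Positivity of the permanent makes it the square root of its own square.\<close>
  also have "\<dots> = bethe_permanent 2 A / permanent A"
    using assms(4) by (simp add: bethe_permanent_2[OF assms(2)] real_sqrt_divide)
  finally show ?thesis by simp
qed

end
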